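(* Let $f(t)=\sum_{k\ge 0} f_k\frac{t^k}{k!}$ be a formal power series with complex coefficients and $f_0\neq 0$, and let $h(t)=\frac{f'(t)}{f(t)}$. Let $M=\left(\frac1f\right)(D)\,X\,f(D)$. Then $$M=\left(\frac{1}{f}\right)(D)\,X\,f(D)=X+h(D).$$
   Context: All matrices are infinite complex matrices $[a_{j,k}]$ with indices running over the non-negative integers, and all those considered satisfy $a_{j,k}=0$ whenever $j-k<m$ for some integer $m$ depending on the matrix, so that products involve only finite sums. $X$ is the matrix with $X_{j,j+1}=1$ for $j\ge 0$ and all other entries zero. $D$ is the matrix with $D_{k+1,k}=k+1$ for $k\ge 0$ and all other entries zero. For a formal power series $a(t)=\sum_{k\ge 0}a_k\frac{t^k}{k!}$, $a(D)=\sum_{k\ge 0}a_k\frac{D^k}{k!}$ (a well-defined lower triangular matrix, with $D^0=I$ the identity). $f'$ is the formal derivative, and $1/f$ is the multiplicative inverse of $f$ as a formal power series. *)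

theory Defs
  imports
    Complex_Main
    "HOL-Computational_Algebra.Formal_Power_Series"
    "HOL-Library.Groups_Big_Fun"
begin

text \<open>
  Infinite complex matrices, rows and columns indexed by \<^typ>\<open>nat\<close>, whose entries vanish
  far enough above the diagonal. Every row then has finite support, so the sums in a matrix
  product are finite.
\<close>

typedef inf_mat =
  "{A :: nat \<Rightarrow> nat \<Rightarrow> complex. \<exists>m::int. \<forall>j k. int j - int k < m \<longrightarrow> A j k = 0}"
  morphisms entry Abs_inf_mat
  by (rule exI[of _ "\<lambda>_ _. 0"]) simp

setup_lifting type_definition_inf_mat

lemma inf_mat_eqI: "(\<And>j k. entry A j k = entry B j k) \<Longrightarrow> A = B"
  by (metis entry_inject ext)

lemma Sum_any_eq_sum:
  fixes g :: "nat \<Rightarrow> complex"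
  assumes "\<And>i. i > N \<Longrightarrow> g i = 0"
  shows "Sum_any g = (\<Sum>i\<le>N. g i)"
  by (rule Sum_any.expand_superset) (use assms not_le in auto)

lemma row_bound:
  fixes a :: "nat \<Rightarrow> complex"
  assumes "\<forall>k. int j - int k < m \<longrightarrow> a k = 0"
  shows "\<exists>N. \<forall>k>N. a k = 0"
proof (intro exI allI impI)
  fix k assume "k > nat (int j - m)"
  then have "int j - int k < m" by linarith
  then show "a k = 0" using assms by blast
qed

lemma row_bound_entry: "\<exists>N. \<forall>k>N. entry A j k = 0"
proof -
  obtain m :: int where "\<forall>j k. int j - int k < m \<longrightarrow> entry A j k = 0"
    using entry[of A] by auto
  then show ?thesis by (intro row_bound[of j m]) simp
qed

lemma row_bound_entry_upto: "\<exists>N. \<forall>j\<le>J. \<forall>k>N. entry A j k = 0"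
proof (induction J)
  case 0
  then show ?case using row_bound_entry[of A 0] by simp
next
  case (Suc J)
  then obtain N where N: "\<forall>j\<le>J. \<forall>k>N. entry A j k = 0" by blast
  obtain N' where N': "\<forall>k>N'. entry A (Suc J) k = 0" using row_bound_entry by blast
  show ?case
    by (rule exI[of _ "max N N'"]) (use N N' in \<open>auto simp: le_Suc_eq\<close>)
qed

instantiation inf_mat :: ring_1
begin

lift_definition zero_inf_mat :: inf_mat is "\<lambda>_ _. 0"
  by simp

lift_definition one_inf_mat :: inf_mat is "\<lambda>j k. if j = k then 1 else 0"
  by (rule exI[of _ 0]) auto

lift_definition plus_inf_mat :: "inf_mat \<Rightarrow> inf_mat \<Rightarrow> inf_mat" is
  "\<lambda>A B j k. A j k + B j k"
proof -
  fix A B :: "nat \<Rightarrow> nat \<Rightarrow> complex"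
  assume "\<exists>m::int. \<forall>j k. int j - int k < m \<longrightarrow> A j k = 0"
    and "\<exists>m::int. \<forall>j k. int j - int k < m \<longrightarrow> B j k = 0"
  then obtain m n :: int where "\<forall>j k. int j - int k < m \<longrightarrow> A j k = 0"
    and "\<forall>j k. int j - int k < n \<longrightarrow> B j k = 0" by blast
  then show "\<exists>m::int. \<forall>j k. int j - int k < m \<longrightarrow> A j k + B j k = 0"
    by (intro exI[of _ "min m n"]) simp
qed

lift_definition uminus_inf_mat :: "inf_mat \<Rightarrow> inf_mat" is "\<lambda>A j k. - A j k"
  by simp

definition minus_inf_mat :: "inf_mat \<Rightarrow> inf_mat \<Rightarrow> inf_mat" where
  "minus_inf_mat A B = A + - B"

lift_definition times_inf_mat :: "inf_mat \<Rightarrow> inf_mat \<Rightarrow> inf_mat" is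
  "\<lambda>A B j k. Sum_any (\<lambda>i. A j i * B i k)"
proof -
  fix A B :: "nat \<Rightarrow> nat \<Rightarrow> complex"
  assume "\<exists>m::int. \<forall>j k. int j - int k < m \<longrightarrow> A j k = 0"
    and "\<exists>m::int. \<forall>j k. int j - int k < m \<longrightarrow> B j k = 0"
  then obtain m n :: int where A: "\<And>j k. int j - int k < m \<Longrightarrow> A j k = 0"
    and B: "\<And>j k. int j - int k < n \<Longrightarrow> B j k = 0" by blast
  show "\<exists>m::int. \<forall>j k. int j - int k < m \<longrightarrow> Sum_any (\<lambda>i. A j i * B i k) = 0"
  proof (intro exI[of _ "m + n"] allI impI)
    fix j k assume *: "int j - int k < m + n"
    have "A j i * B i k = 0" for i
    proof (cases "int j - int i < m")
      case False
      then have "int i - int k < n" using * by linarith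
      then show ?thesis using B by simp
    qed (use A in simp)
    then show "Sum_any (\<lambda>i. A j i * B i k) = 0" by (simp only:) simp
  qed
qed

lemma entry_times:
  assumes "\<forall>i>N. entry A j i = 0"
  shows "entry (A * B) j k = (\<Sum>i\<le>N. entry A j i * entry B i k)"
  unfolding times_inf_mat.rep_eq by (rule Sum_any_eq_sum) (use assms in simp)

instance
proof
  fix A B C :: inf_mat
  show "A * B * C = A * (B * C)"
  proof (rule inf_mat_eqI)
    fix j k
    obtain N where N: "\<forall>i>N. entry A j i = 0" using row_bound_entry by blast
    obtain L where L: "\<forall>i\<le>N. \<forall>l>L. entry B i l = 0" using row_bound_entry_upto by blast
    have AB: "entry (A * B) j l = (\<Sum>i\<le>N. entry A j i * entry B i l)" for l
      using entry_times[OF N] .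
    have "\<forall>l>L. entry (A * B) j l = 0" using L by (simp add: AB)
    then have "entry (A * B * C) j k = (\<Sum>l\<le>L. entry (A * B) j l * entry C l k)"
      by (rule entry_times)
    also have "\<dots> = (\<Sum>i\<le>N. \<Sum>l\<le>L. entry A j i * (entry B i l * entry C l k))"
      by (simp add: AB sum_distrib_right mult.assoc sum.swap[of _ "{..L}"])
    also have "\<dots> = (\<Sum>i\<le>N. entry A j i * entry (B * C) i k)"
      by (intro sum.cong refl, subst entry_times[of L]) (use L in \<open>auto simp: sum_distrib_left\<close>)
    also have "\<dots> = entry (A * (B * C)) j k" using entry_times[OF N] by simp
    finally show "entry (A * B * C) j k = entry (A * (B * C)) j k" .
  qed
  show "A + B + C = A + (B + C)" by (rule inf_mat_eqI) (simp add: plus_inf_mat.rep_eq)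
  show "A + B = B + A" by (rule inf_mat_eqI) (simp add: plus_inf_mat.rep_eq)
  show "0 + A = A"
    by (rule inf_mat_eqI) (simp add: plus_inf_mat.rep_eq zero_inf_mat.rep_eq)
  show "- A + A = 0"
    by (rule inf_mat_eqI) (simp add: plus_inf_mat.rep_eq zero_inf_mat.rep_eq uminus_inf_mat.rep_eq)
  show "A - B = A + - B" by (simp add: minus_inf_mat_def)
  show "1 * A = A"
  proof (rule inf_mat_eqI)
    fix j k
    have "\<forall>i>j. entry 1 j i = 0" by (simp add: one_inf_mat.rep_eq)
    from entry_times[OF this] show "entry (1 * A) j k = entry A j k"
      by (simp add: one_inf_mat.rep_eq if_distrib[of "\<lambda>x. x * _"] cong: if_cong)
  qed
  show "A * 1 = A"
  proof (rule inf_mat_eqI)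
    fix j k
    obtain N where N: "\<forall>i>N. entry A j i = 0" using row_bound_entry by blast
    show "entry (A * 1) j k = entry A j k"
      using N by (simp add: entry_times[OF N] one_inf_mat.rep_eq if_distrib cong: if_cong)
  qed
  show "(A + B) * C = A * C + B * C"
  proof (rule inf_mat_eqI)
    fix j k
    obtain N where N: "\<forall>i>N. entry A j i = 0" using row_bound_entry by blast
    obtain L where L: "\<forall>i>L. entry B j i = 0" using row_bound_entry by blast
    have "\<forall>i>max N L. entry A j i = 0" "\<forall>i>max N L. entry B j i = 0"
      "\<forall>i>max N L. entry (A + B) j i = 0"
      using N L by (simp_all add: plus_inf_mat.rep_eq)
    from this[THEN entry_times] show "entry ((A + B) * C) j k = entry (A * C + B * C) j k"
      by (simp add: plus_inf_mat.rep_eq distrib_right sum.distrib)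
  qed
  show "A * (B + C) = A * B + A * C"
  proof (rule inf_mat_eqI)
    fix j k
    obtain N where N: "\<forall>i>N. entry A j i = 0" using row_bound_entry by blast
    show "entry (A * (B + C)) j k = entry (A * B + A * C) j k"
      by (simp add: plus_inf_mat.rep_eq entry_times[OF N] distrib_left sum.distrib)
  qed
  show "(0::inf_mat) \<noteq> 1"
  proof
    assume "(0::inf_mat) = 1"
    then have "entry 0 0 0 = entry 1 0 0" by simp
    then show False by (simp add: zero_inf_mat.rep_eq one_inf_mat.rep_eq)
  qed
qed

end

lift_definition mat_X :: inf_mat is "\<lambda>j k. if k = j + 1 then 1 else 0"
  by (rule exI[of _ "- 1"]) auto

lift_definition mat_D :: inf_mat is "\<lambda>j k. if j = k + 1 then of_nat (k + 1) else 0"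
  by (rule exI[of _ 0]) auto

lemma entry_mat_D_power_eq_0: "j \<noteq> k + n \<Longrightarrow> entry (mat_D ^ n) j k = 0"
proof (induction n arbitrary: j k)
  case 0
  then show ?case by (simp add: one_inf_mat.rep_eq)
next
  case (Suc n)
  have "entry mat_D j i * entry (mat_D ^ n) i k = 0" for i
    using Suc by (cases "j = i + 1") (auto simp: mat_D.rep_eq)
  then show ?case by (simp only: power_Suc times_inf_mat.rep_eq) simp
qed

text \<open>
  The series \<open>a(t) = \<Sum>\<^sub>n a\<^sub>n t\<^sup>n / n!\<close> is represented by the \<^typ>\<open>complex fps\<close> whose \<open>n\<close>-th
  coefficient is \<open>fps_nth a n = a\<^sub>n / n!\<close>, so \<open>a(D) = \<Sum>\<^sub>n fps_nth a n D\<^sup>n\<close>. The sum is taken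
  entrywise; by \<open>entry_mat_D_power_eq_0\<close> at most one summand contributes to each entry.
\<close>

lift_definition fps_at_D :: "complex fps \<Rightarrow> inf_mat" is
  "\<lambda>a j k. Sum_any (\<lambda>n. fps_nth a n * entry (mat_D ^ n) j k)"
proof (intro exI[of _ 0] allI impI)
  fix a :: "complex fps" and j k :: nat
  assume "int j - int k < 0"
  then have "entry (mat_D ^ n) j k = 0" for n by (intro entry_mat_D_power_eq_0) simp
  then show "Sum_any (\<lambda>n. fps_nth a n * entry (mat_D ^ n) j k) = 0" by simp
qed

end

(* The map a \<mapsto> a(D) is a ring homomorphism, and the relation X D - D X = I says that
   commuting with X acts on it as formal differentiation: X a(D) = a(D) X + a'(D).
   Taking a = f and multiplying by (1/f)(D) on the left gives the claim. *)
theory Submission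
  imports Defs
begin

text \<open>Each factor \<open>mat_D\<close> lowers the diagonal by one, so exactly one product of
  entries leads from column \<open>k\<close> to row \<open>k + n\<close>. Its factors are k+1, ...,
  k+n, hence the quotient of factorials.\<close>

lemma entry_mat_D_power:
  "entry (mat_D ^ n) j k = (if j = k + n then fact j / fact k else 0)"
proof (induction n arbitrary: j)
  case 0
  then show ?case by (simp add: one_inf_mat.rep_eq)
next
  case (Suc n)
  show ?case
  proof (cases j)
    case 0
    then show ?thesis by (simp add: entry_mat_D_power_eq_0 del: power_Suc)
  next
    case (Suc j')
    have "\<forall>i>j'. entry mat_D j i = 0"
      using Suc by (simp add: mat_D.rep_eq)
    from entry_times[OF this]
    have "entry (mat_D ^ Suc n) j k = (\<Sum>i\<le>j'. entry mat_D j i * entry (mat_D ^ n) i k)"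
      by simp
    also have "\<dots> = (\<Sum>i\<le>j'. if i = j' then of_nat j * entry (mat_D ^ n) j' k else 0)"
      using Suc by (intro sum.cong) (auto simp: mat_D.rep_eq)
    also have "\<dots> = of_nat j * entry (mat_D ^ n) j' k" by simp
    finally show ?thesis
      using Suc by (simp add: Suc.IH)
  qed
qed

lemma entry_fps_at_D:
  "entry (fps_at_D a) j k = (if k \<le> j then fps_nth a (j - k) * fact j / fact k else 0)"
proof -
  \<comment> \<open>A nonzero summand needs \<open>j = k + n\<close>, so \<open>n\<close> is at most
    \<open>j\<close>.\<close>
  have "entry (fps_at_D a) j k = (\<Sum>n\<le>j. fps_nth a n * entry (mat_D ^ n) j k)"
    unfolding fps_at_D.rep_eq by (rule Sum_any_eq_sum) (simp add: entry_mat_D_power)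
  also have "\<dots> = (\<Sum>n\<le>j. if n = j - k then
      (if k \<le> j then fps_nth a (j - k) * fact j / fact k else 0) else 0)"
    by (intro sum.cong) (auto simp: entry_mat_D_power)
  finally show ?thesis by simp
qed

lemma entry_fps_at_D_times:
  "entry (fps_at_D a * B) j k = (\<Sum>i\<le>j. entry (fps_at_D a) j i * entry B i k)"
  by (rule entry_times) (simp add: entry_fps_at_D)

lemma entry_mat_X_times: "entry (mat_X * B) j k = entry B (Suc j) k"
proof -
  have "\<forall>i>Suc j. entry mat_X j i = 0" by (simp add: mat_X.rep_eq)
  from entry_times[OF this] show ?thesis
    by (simp add: mat_X.rep_eq if_distrib[of "\<lambda>x. x * _"] cong: if_cong)
qed

lemma entry_fps_at_D_times_mat_X:
  "entry (fps_at_D a * mat_X) j k = (if k = 0 then 0 else entry (fps_at_D a) j (k - 1))"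
proof (cases k)
  case 0
  then show ?thesis by (simp add: entry_fps_at_D_times mat_X.rep_eq)
next
  case (Suc k')
  \<comment> \<open>The sum over \<open>i \<le> j\<close> misses the index \<open>k'\<close> when
    \<open>k' > j\<close>; the second \<open>simp\<close> settles that case, where the entry is zero
    by triangularity.\<close>
  then show ?thesis
    by (simp add: entry_fps_at_D_times mat_X.rep_eq if_distrib cong: if_cong)
       (simp add: entry_fps_at_D)
qed

lemma fps_at_D_1 [simp]: "fps_at_D 1 = 1"
  by (rule inf_mat_eqI) (auto simp: entry_fps_at_D one_inf_mat.rep_eq)

text \<open>The weights j!/i! and i!/k! telescope to j!/k! independently of \<open>i\<close>, which
  leaves a Cauchy product.\<close>

lemma fps_at_D_mult: "fps_at_D (a * b) = fps_at_D a * fps_at_D b"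
proof (rule inf_mat_eqI)
  fix j k
  show "entry (fps_at_D (a * b)) j k = entry (fps_at_D a * fps_at_D b) j k"
  proof (cases "k \<le> j")
    case True
    have "entry (fps_at_D a * fps_at_D b) j k =
        (\<Sum>i\<in>{k..j}. fps_nth a (j - i) * fps_nth b (i - k) * (fact j / fact k))"
      unfolding entry_fps_at_D_times
      by (rule sum.mono_neutral_cong_right) (auto simp: entry_fps_at_D)
    also have "\<dots> = (\<Sum>i=0..j - k. fps_nth a i * fps_nth b (j - k - i) * (fact j / fact k))"
      by (rule sum.reindex_bij_witness[of _ "\<lambda>i. j - i" "\<lambda>i. j - i"]) (use True in auto)
    also have "\<dots> = entry (fps_at_D (a * b)) j k"
      using True by (simp add: entry_fps_at_D fps_mult_nth sum_distrib_right sum_divide_distrib)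
    finally show ?thesis ..
  qed (auto simp: entry_fps_at_D_times entry_fps_at_D intro!: sum.neutral)
qed

text \<open>On the left \<open>mat_X\<close> shifts rows and on the right columns, so both products
  carry the same coefficient of \<open>a\<close>, at j+1-k. Their weights differ by (j+1)!/k! -
  j!/(k-1)! = (j+1-k) j!/k!, the factor that differentiation produces.\<close>

lemma mat_X_times_fps_at_D:
  "mat_X * fps_at_D a = fps_at_D a * mat_X + fps_at_D (fps_deriv a)"
proof (rule inf_mat_eqI)
  fix j k
  \<comment> \<open>The generic case is 1 \<le> k \<le> j. For \<open>k = 0\<close> the column shift
    gives zero; for \<open>k = Suc j\<close> the derivative term vanishes and both products equal
    the constant term of \<open>a\<close>; beyond that all entries are zero.\<close>
  consider "k = 0" | k' where "k = Suc k'" "k' < j" | "k = Suc j" | "k > Suc j"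
    by (cases k) (auto, linarith)
  then show "entry (mat_X * fps_at_D a) j k =
      entry (fps_at_D a * mat_X + fps_at_D (fps_deriv a)) j k"
  proof cases
    case 2
    define b c where "b = fps_nth a (j - k')" and "c = (fact j / fact k :: complex)"
    have Suc_diff: "Suc (j - k) = j - k'"
      using 2 by simp
    have "entry (mat_X * fps_at_D a) j k = of_nat (Suc j) * b * c"
      using 2 by (simp add: entry_mat_X_times entry_fps_at_D b_def c_def)
    moreover have "entry (fps_at_D a * mat_X) j k = of_nat k * b * c"
      using 2 by (simp add: entry_fps_at_D_times_mat_X entry_fps_at_D b_def c_def del: of_nat_Suc)
    moreover have "entry (fps_at_D (fps_deriv a)) j k = of_nat (j - k') * b * c"
      using 2 Suc_diff by (simp add: entry_fps_at_D b_def c_def del: of_nat_Suc)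
    \<comment> \<open>What remains is j+1 = k + (j-k') with k = k'+1.\<close>
    ultimately show ?thesis
      using 2 by (simp add: plus_inf_mat.rep_eq of_nat_diff algebra_simps)
  next
    case 3
    then show ?thesis
      by (simp add: plus_inf_mat.rep_eq entry_mat_X_times entry_fps_at_D_times_mat_X
          entry_fps_at_D del: fact_Suc)
  qed (auto simp: plus_inf_mat.rep_eq entry_mat_X_times entry_fps_at_D_times_mat_X
      entry_fps_at_D algebra_simps)
qed

theorem theorem4p1:
  fixes f h :: "complex fps" and M :: inf_mat
  assumes "fps_nth f 0 \<noteq> 0"
    and "h = fps_deriv f / f"
    and "M = fps_at_D (inverse f) * mat_X * fps_at_D f"
  shows "M = mat_X + fps_at_D h"
proof -
  have "M = fps_at_D (inverse f) * fps_at_D f * mat_X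
      + fps_at_D (inverse f) * fps_at_D (fps_deriv f)"
    by (simp add: assms(3) mult.assoc mat_X_times_fps_at_D distrib_left)
  also have "\<dots> = mat_X + fps_at_D (inverse f * fps_deriv f)"
    by (simp add: assms(1) inverse_mult_eq_1 flip: fps_at_D_mult)
  \<comment> \<open>The nonzero constant term makes \<open>f\<close> a unit, so dividing by it is
    multiplying by \<open>inverse f\<close>.\<close>
  also have "inverse f * fps_deriv f = h"
    by (simp add: assms(1,2) fps_divide_unit mult.commute)
  finally show ?thesis .
qed

end
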